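(* Let $X$ be a Laplacian random variable with parameters $(a,b)=(0,1)$, i.e. with probability density function $f(x)=\frac{1}{2}e^{-|x|}$ for $x\in(-\infty,\infty)$, and let $(X_j)_{j\ge 1}$ be a sequence of mutually independent random variables, each having the same distribution as $X$. Let $Y=\sum_{k=1}^{\infty}\frac{X_k}{2k\pi}$. Then for every positive integer $n$, \[ E\big[Y^{2n}\big]=(-1)^{n}\Big(\frac{2n}{2^{2n}}E_{2n-1}+B_{2n}\Big), \] and \[ E\big[Y^{2n-1}\big]=0 . \]
   Context: The Bernoulli numbers $B_n$ and Euler numbers $E_n$ are defined by the generating functions $\frac{t}{e^{t}-1}=\sum_{n=0}^{\infty}B_n\frac{t^n}{n!}$ and $\frac{2}{e^{t}+1}=\sum_{n=0}^{\infty}E_n\frac{t^n}{n!}$. (With this convention, $E_1=-\tfrac12$, $E_3=\tfrac14$, $E_5=-\tfrac12$, and $E_{2k}=0$ for $k\ge1$.) *)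

theory Defs
  imports "HOL-Probability.Probability" "HOL-Computational_Algebra.Formal_Power_Series"
begin

definition bernoulli_num :: "nat \<Rightarrow> real" where
  "bernoulli_num n = fact n * fps_nth (fps_X / (fps_exp 1 - 1)) n"

text \<open>
  These are \<^emph>\<open>not\<close> the Euler numbers with generating function \<open>1 / cosh t\<close>: the convention here is
  \<open>2 / (exp t + 1)\<close>, i.e. the values at \<open>0\<close> of the Euler polynomials.
\<close>

definition euler_num :: "nat \<Rightarrow> real" where
  "euler_num n = fact n * fps_nth (2 / (fps_exp 1 + 1)) n"

lemma bernoulli_num_generating_function:
  "Abs_fps (\<lambda>n. bernoulli_num n / fact n) * (fps_exp 1 - 1) = fps_X"
proof -
  have nth1: "fps_nth (fps_exp (1::real) - 1) 1 = 1" by simp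
  then have nz: "fps_exp (1::real) - 1 \<noteq> 0" by (metis fps_zero_nth zero_neq_one)
  have "subdegree (fps_exp (1::real) - 1) = 1"
    by (rule subdegreeI) auto
  then have "fps_exp (1::real) - 1 dvd fps_X"
    using nz by (simp add: fps_dvd_iff)
  moreover have "Abs_fps (\<lambda>n. bernoulli_num n / fact n) = fps_X / (fps_exp 1 - 1)"
    by (simp add: fps_eq_iff bernoulli_num_def)
  ultimately show ?thesis by simp
qed

lemma euler_num_generating_function:
  "Abs_fps (\<lambda>n. euler_num n / fact n) * (fps_exp 1 + 1) = 2"
proof -
  have "is_unit (fps_exp (1::real) + 1)" by (simp add: fps_is_unit_iff)
  then have "fps_exp (1::real) + 1 dvd 2" by (rule unit_imp_dvd)
  moreover have "Abs_fps (\<lambda>n. euler_num n / fact n) = 2 / (fps_exp 1 + 1)"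
    by (simp add: fps_eq_iff euler_num_def)
  ultimately show ?thesis by simp
qed

end

theory Submission
  imports Defs "HOL-Complex_Analysis.Cauchy_Integral_Formula"
begin

text \<open>
  Let \<open>S n\<close> be the partial sums of the series. Since \<open>\<integral> exp (z x) f(x) dx = 1 / (1 - z\<^sup>2)\<close> for
  \<open>\<bar>Re z\<bar> < 1\<close> and \<open>\<Prod>(1 - x\<^sub>i) \<ge> 1 - \<Sum> x\<^sub>i\<close>, independence yields
  \<open>E[cosh (sqrt (n + 1) (S m - S n))] \<le> 2\<close> for all \<open>m \<ge> n\<close>. This single bound drives the
  convergence: it makes \<open>S (4 ^ k)\<close> converge almost surely to some \<open>L\<close>, and by Fatou's lemma
  \<open>E[(L - S n) ^ 4] = O(1 / n\<^sup>2)\<close>, so that \<open>\<Sum> (L - S n) ^ 4 < \<infinity>\<close> almost surely and the whole sequence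
  converges. It also gives \<open>E[cosh Y] \<le> 2\<close>, hence \<open>E[\<bar>Y\<bar> ^ n] \<le> 4 n!\<close>.

  By Euler's product for the sine, the characteristic function of \<open>Y\<close> is \<open>t / (exp (t/2) - exp (-t/2))\<close>.
  Its expansion has the moments of \<open>Y\<close> as coefficients, and the identity
  \<open>t / (exp (t/2) - exp (-t/2)) = t / (exp (t/2) + 1) + t / (exp t - 1)\<close>
  expresses them by Euler and Bernoulli numbers.
\<close>

section \<open>Exponential transform of the Laplace density\<close>

text \<open>The antiderivative \<open>- exp (- w * x) / w\<close> tends to \<open>- 1 / w\<close> at
  0 and, because \<open>Re w > 0\<close>, to 0 at infinity.\<close>

lemma has_bochner_integral_exp_Ioi:
  fixes w :: complex
  assumes "Re w > 0"
  shows "has_bochner_integral lborel (\<lambda>x. indicator {0<..} x *\<^sub>R exp (- w * of_real x)) (1 / w)"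
proof -
  have [simp]: "w \<noteq> 0" using assms by auto
  have int: "set_integrable lborel {0<..} (\<lambda>x. exp (- w * of_real x))"
    using integrable_I0i_exp_mscale[OF assms] unfolding set_integrable_def
    by (rule Bochner_Integration.integrable_bound)
       (auto simp: indicator_def norm_exp_eq_Re mult.commute)
  have "(LBINT x=0..\<infinity>. exp (- w * of_real x)) = 0 - (- 1 / w)"
  proof (rule interval_integral_FTC_integrable[where F = "\<lambda>x. - exp (- w * of_real x) / w"])
    show "((\<lambda>x. - exp (- w * of_real x) / w) has_vector_derivative exp (- w * of_real x)) (at x)" for x
      by (auto intro!: derivative_eq_intros has_vector_derivative_real_field)
    show "set_integrable lborel (einterval 0 \<infinity>) (\<lambda>x. exp (- w * of_real x))"
      using int by (simp add: zero_ereal_def einterval_eq_Ici)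
    show "(((\<lambda>x. - exp (- w * of_real x) / w) \<circ> real_of_ereal) \<longlongrightarrow> - 1 / w) (at_right 0)"
      unfolding zero_ereal_def ereal_tendsto_simps by (auto intro!: tendsto_eq_intros)
    show "(((\<lambda>x. - exp (- w * of_real x) / w) \<circ> real_of_ereal) \<longlongrightarrow> 0) (at_left \<infinity>)"
      unfolding ereal_tendsto_simps
    proof (rule tendsto_norm_zero_cancel)
      have "((\<lambda>x. exp (- Re w * x) / norm w) \<longlongrightarrow> 0) at_top"
        using assms by real_asymp
      then show "((\<lambda>x. norm (- exp (- w * of_real x) / w)) \<longlongrightarrow> 0) at_top"
        by (simp add: norm_divide norm_exp_eq_Re)
    qed
  qed auto
  moreover have "(LBINT x=0..\<infinity>. exp (- w * of_real x))
      = integral\<^sup>L lborel (\<lambda>x. indicator {0<..} x *\<^sub>R exp (- w * of_real x))"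
    by (simp add: zero_ereal_def interval_lebesgue_integral_0_infty set_lebesgue_integral_def
          interval_lebesgue_integral_def einterval_eq_Ici)
  ultimately show ?thesis
    using int by (simp add: has_bochner_integral_iff set_integrable_def)
qed

text \<open>Splitting at 0 leaves half-line integrals with parameters \<open>1 - z\<close> and
  \<open>1 + z\<close>, both of positive real part; the mean of their reciprocals is
  \<open>1 / (1 - z\<^sup>2)\<close>.\<close>

lemma has_bochner_integral_laplace_exp:
  fixes z :: complex
  assumes "\<bar>Re z\<bar> < 1"
  shows "has_bochner_integral lborel (\<lambda>x. (1 / 2 * exp (- \<bar>x\<bar>)) *\<^sub>R exp (z * of_real x)) (1 / (1 - z\<^sup>2))"
proof -
  have nz: "1 - z \<noteq> 0" "1 + z \<noteq> 0" using assms
    by (auto simp: complex_eq_iff)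
  let ?f = "\<lambda>w x. indicator {0<..} x *\<^sub>R exp (- w * of_real x) :: complex"
  have 1: "has_bochner_integral lborel (?f (1 - z)) (1 / (1 - z))"
    using assms by (intro has_bochner_integral_exp_Ioi) auto
  have "has_bochner_integral lborel (?f (1 + z)) (1 / (1 + z))"
    using assms by (intro has_bochner_integral_exp_Ioi) auto
  then have 2: "has_bochner_integral lborel (\<lambda>x. ?f (1 + z) (- x)) (1 / (1 + z))"
    using lborel_has_bochner_integral_real_affine_iff[of "-1" "?f (1 + z)" "1 / (1 + z)" 0] by simp
  have "has_bochner_integral lborel (\<lambda>x. (1/2) *\<^sub>R (?f (1 - z) x + ?f (1 + z) (- x)))
          ((1/2) *\<^sub>R (1 / (1 - z) + 1 / (1 + z)))"
    by (intro has_bochner_integral_scaleR_right has_bochner_integral_add 1 2) 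
  also have "(1/2) *\<^sub>R (1 / (1 - z) + 1 / (1 + z)) = 1 / (1 - z\<^sup>2)"
  proof -
    have "1 - z\<^sup>2 = (1 - z) * (1 + z)" by (simp add: algebra_simps power2_eq_square)
    then show ?thesis using nz by (simp add: scaleR_conv_of_real divide_simps)
  qed
  finally have "has_bochner_integral lborel (\<lambda>x. (1/2) *\<^sub>R (?f (1 - z) x + ?f (1 + z) (- x)))
      (1 / (1 - z\<^sup>2))" .
  also have "?this \<longleftrightarrow> ?thesis"
  proof (rule has_bochner_integral_cong_AE)
    \<comment> \<open>Both open half-lines miss 0, where the left side is 0 and the right side 1/2;
      this single point is null.\<close>
    show "AE x in lborel. (1/2) *\<^sub>R (?f (1 - z) x + ?f (1 + z) (- x)) =
        (1 / 2 * exp (- \<bar>x\<bar>)) *\<^sub>R exp (z * of_real x)"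
      using AE_lborel_singleton[of 0]
      by eventually_elim
        (auto simp: indicator_def scaleR_conv_of_real exp_of_real[symmetric] exp_add[symmetric]
           algebra_simps abs_if)
  qed auto
  finally show ?thesis .
qed

section \<open>Elementary inequalities and uniqueness of power series\<close>

text \<open>Weierstrass's product inequality: a new factor lowers the product by \<open>f i\<close>
  times a number that is at most 1.\<close>

lemma one_minus_sum_le_prod:
  fixes f :: "'b \<Rightarrow> real"
  assumes "\<And>i. i \<in> I \<Longrightarrow> 0 \<le> f i \<and> f i \<le> 1"
  shows "1 - sum f I \<le> (\<Prod>i\<in>I. 1 - f i)"
  using assms
proof (induction I rule: infinite_finite_induct)
  case (insert i I)
  have le: "(\<Prod>i\<in>I. 1 - f i) \<le> 1" using insert.prems
    by (intro prod_le_1) auto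
  have "f i * (\<Prod>i\<in>I. 1 - f i) \<le> f i * 1"
    using insert.prems le by (intro mult_left_mono) auto
  with insert show ?case by (simp add: algebra_simps)
qed auto

text \<open>Telescoping against \<open>2 / (k + 1) - 2 / (k + 2)\<close>. The decay in
  \<open>n\<close> later cancels the choice \<open>t\<^sup>2 = real n + 1\<close>.\<close>

lemma sum_inverse_squares_le:
  "(\<Sum>k=n..<m. 1 / (real k + 1)\<^sup>2) \<le> 2 / (real n + 1)"
proof (cases "n \<le> m")
  case True
  \<comment> \<open>The subtracted term makes the bound inductive and is dropped afterwards.\<close>
  have "(\<Sum>k=n..<m. 1 / (real k + 1)\<^sup>2) \<le> 2 / (real n + 1) - 2 / (real m + 1)"
    using True
  proof (induction m rule: dec_induct)
    case (step m)
    have "1 / (real m + 1)\<^sup>2 \<le> 2 / (real m + 1) - 2 / (real (Suc m) + 1)"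
      by (simp add: divide_simps power2_eq_square)
    with step show ?case by simp
  qed simp
  moreover have "2 / (real m + 1) \<ge> 0" by simp
  ultimately show ?thesis by linarith
qed simp

text \<open>Zeros of a nontrivial power series are isolated, so a nonzero coefficient would make the
  zero function nonzero on a punctured ball.\<close>

lemma powser_eq_0_imp_coeff_0:
  fixes a :: "nat \<Rightarrow> 'b :: {real_normed_field, banach}"
  assumes "r > 0" and sums: "\<And>x. norm x < r \<Longrightarrow> (\<lambda>n. a n * x ^ n) sums 0"
  shows "a m = 0"
proof (rule ccontr)
  assume nz: "a m \<noteq> 0"
  \<comment> \<open>\<open>powser_0_nonzero\<close> wants a nonzero coefficient of positive index,
    so the constant term is settled by evaluation at 0.\<close>
  have "a 0 = 0" using sums[of 0] assms(1) by simp
  with nz have "m > 0" by (cases m) auto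
  show False
  proof (rule powser_0_nonzero[of r 0 a "\<lambda>_. 0" m, OF \<open>r > 0\<close> _ refl nz \<open>m > 0\<close>])
    show "(\<lambda>n. a n * (x - 0) ^ n) sums 0" if "norm (x - 0) < r" for x
      using sums that by simp
    fix s :: real assume s: "0 < s" "\<And>z. z \<in> cball (0::'b) s - {0} \<Longrightarrow> (0::'b) \<noteq> 0"
    have "of_real s \<in> cball (0::'b) s - {0}" using s(1) by auto
    from s(2)[OF this] show False by simp
  qed
qed

text \<open>A single term of the exponential series is at most \<open>exp \<bar>x\<bar>\<close>.
  This turns bounds on cosh into bounds on moments of every order.\<close>

lemma abs_power_le_cosh: "\<bar>x\<bar> ^ n \<le> 2 * fact n * cosh x" for x :: real
proof -
  have "(\<Sum>k\<in>{n}. \<bar>x\<bar> ^ k /\<^sub>R fact k) \<le> (\<Sum>k. \<bar>x\<bar> ^ k /\<^sub>R fact k)"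
    by (rule sum_le_suminf) (use summable_exp_generic[of "\<bar>x\<bar>"] in auto)
  then have "\<bar>x\<bar> ^ n / fact n \<le> exp \<bar>x\<bar>"
    by (simp add: exp_def divide_inverse_commute)
  also have "\<dots> \<le> 2 * cosh x"
    by (auto simp: cosh_def abs_if)
  finally show ?thesis by (simp add: field_simps)
qed

section \<open>Splitting the generating function into Euler and Bernoulli parts\<close>

text \<open>With \<open>e = exp (t/2)\<close> the hypothesis reads
  \<open>F = t e / (e\<^sup>2 - 1)\<close>; writing the numerator as \<open>t (e - 1) + t\<close>
  gives \<open>t / (e + 1) + t / (e\<^sup>2 - 1)\<close>. The identities are kept as products, with
  one cancellation of \<open>e * e - 1\<close> at the end.\<close>

lemma moment_fps_eq:
  fixes F :: "real fps"
  assumes F: "F * (fps_exp (1/2) - fps_exp (-(1/2))) = fps_X"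
  shows "fact n * fps_nth F n = real n / 2 ^ n * euler_num (n - 1) + bernoulli_num n"
proof -
  define e :: "real fps" where "e = fps_exp (1/2)"
  define E where "E = Abs_fps (\<lambda>n. euler_num n / fact n)"
  define B where "B = Abs_fps (\<lambda>n. bernoulli_num n / fact n)"
  define h :: "real fps" where "h = fps_const (1/2) * fps_X"
  \<comment> \<open>\<open>E oo h\<close> is \<open>2 / (exp (t/2) + 1)\<close>, so \<open>G\<close>
    is \<open>t / (exp (t/2) + 1)\<close>.\<close>
  define G where "G = fps_const (1/2) * fps_X * (E oo h)"
  have ee: "e * e = fps_exp 1"
    by (simp add: e_def fps_exp_add_mult[symmetric])
  have e': "fps_exp (-(1/2)) * e = 1"
    using fps_exp_add_mult[of "-(1/2)" "1/2 :: real"] by (simp add: e_def)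
  have h0: "fps_nth h 0 = 0" by (simp add: h_def)
  have "(E * (fps_exp 1 + 1)) oo h = 2 oo h"
    unfolding E_def by (simp only: euler_num_generating_function)
  then have "(E oo h) * ((fps_exp 1 oo h) + 1) = 2"
    using h0 by (simp add: fps_compose_mult_distrib fps_compose_add_distrib)
  moreover have "fps_exp 1 oo h = e"
    unfolding h_def e_def by (simp add: fps_exp_compose_linear)
  ultimately have E: "(E oo h) * (e + 1) = 2" by simp
  have "fps_const (1/2) * 2 = (1 :: real fps)"
    by (simp add: fps_eq_iff fps_numeral_nth)
  then have G: "G * (e + 1) = fps_X"
    unfolding G_def using E by (simp add: mult.assoc mult.left_commute)
  have B: "B * (e * e - 1) = fps_X"
    unfolding ee B_def by (rule bernoulli_num_generating_function)
  have nz: "e * e - 1 \<noteq> 0" using B by auto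
  have "F * (e * e - 1) = F * (e - fps_exp (-(1/2))) * e"
    using e' by (simp add: algebra_simps)
  also have "\<dots> = fps_X * e" using F by (simp add: e_def)
  also have "\<dots> = G * (e + 1) * (e - 1) + B * (e * e - 1)"
    unfolding G B by (simp add: algebra_simps)
  also have "\<dots> = (G + B) * (e * e - 1)" by (simp add: algebra_simps)
  finally have "F = G + B" using nz by simp
  \<comment> \<open>The factor \<open>fps_X\<close> shifts the index, whence \<open>n - 1\<close>;
    at \<open>n = 0\<close>, where the subtraction truncates, \<open>real n\<close> makes the term
    vanish.\<close>
  moreover have "fps_nth G n = real n / 2 ^ n * euler_num (n - 1) / fact n"
  proof (cases n)
    case (Suc m)
    have "fps_nth G n = 1/2 * (euler_num m / fact m * (1/2) ^ m)"
      unfolding Suc G_def h_def E_def mult.assoc by (simp add: fps_compose_linear)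
    also have "\<dots> = real n / 2 ^ n * euler_num (n - 1) / fact n"
      by (simp add: Suc power_one_over del: of_nat_Suc)
    finally show ?thesis .
  qed (simp add: G_def mult.assoc)
  ultimately show ?thesis by (simp add: B_def field_simps)
qed

lemma abs_cos_coeff_le: "\<bar>cos_coeff n\<bar> \<le> 1 / fact n" and abs_sin_coeff_le: "\<bar>sin_coeff n\<bar> \<le> 1 / fact n"
  by (auto simp: cos_coeff_def sin_coeff_def abs_divide power_abs)

section \<open>Summands, partial sums and their exponential moments\<close>

locale laplace_series = prob_space M for M :: "'a measure" +
  fixes X :: "nat \<Rightarrow> 'a \<Rightarrow> real"
  assumes indep: "indep_vars (\<lambda>_. borel) X {1..}"
    and laplace: "\<And>j. j \<ge> 1 \<Longrightarrow> distributed M lborel (X j) (\<lambda>x. ennreal (1 / 2 * exp (- \<bar>x\<bar>)))"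
begin

definition \<xi> :: "nat \<Rightarrow> 'a \<Rightarrow> real" where
  "\<xi> k \<omega> = X (Suc k) \<omega> / (2 * real (Suc k) * pi)"

definition S :: "nat \<Rightarrow> 'a \<Rightarrow> real" where
  "S n \<omega> = (\<Sum>k<n. \<xi> k \<omega>)"

lemma measurable_X [measurable]: "X (Suc k) \<in> borel_measurable M"
  using laplace[of "Suc k"] by (auto dest: distributed_measurable)

lemma measurable_\<xi> [measurable]: "\<xi> k \<in> borel_measurable M"
  unfolding \<xi>_def[abs_def] by measurable

lemma measurable_S [measurable]: "S n \<in> borel_measurable M"
  unfolding S_def[abs_def] by measurable

lemma has_bochner_integral_exp_\<xi>:
  fixes z :: complex
  assumes "\<bar>Re z\<bar> < 2 * real (Suc k) * pi"
  shows "has_bochner_integral M (\<lambda>\<omega>. exp (z * of_real (\<xi> k \<omega>)))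
    (1 / (1 - (z / of_real (2 * real (Suc k) * pi))\<^sup>2))"
proof -
  define c where "c = 2 * real (Suc k) * pi"
  define f where "f x = 1 / 2 * exp (- \<bar>x\<bar>)" for x :: real
  define g where "g x = exp (z / of_real c * of_real x)" for x :: real
  have c: "c > 0" by (simp add: c_def)
  have [measurable]: "f \<in> borel_measurable borel" "g \<in> borel_measurable borel"
    unfolding f_def[abs_def] g_def[abs_def] by measurable
  have "\<bar>Re (z / of_real c)\<bar> < 1"
    using assms c unfolding c_def[symmetric] by (simp add: Re_divide_of_real abs_divide)
  then have "has_bochner_integral lborel (\<lambda>x. f x *\<^sub>R g x) (1 / (1 - (z / of_real c)\<^sup>2))"
    unfolding f_def g_def by (rule has_bochner_integral_laplace_exp)
  then have "has_bochner_integral (density lborel (\<lambda>x. ennreal (f x))) g (1 / (1 - (z / of_real c)\<^sup>2))"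
    by (intro has_bochner_integral_density) (auto simp: f_def)
  also have "density lborel (\<lambda>x. ennreal (f x)) = distr M lborel (X (Suc k))"
    using laplace[of "Suc k"] by (auto simp: f_def distributed_distr_eq_density)
  finally have "has_bochner_integral M (\<lambda>\<omega>. g (X (Suc k) \<omega>)) (1 / (1 - (z / of_real c)\<^sup>2))"
    by (simp add: has_bochner_integral_iff integrable_distr_eq integral_distr)
  then show ?thesis by (simp add: g_def \<xi>_def c_def)
qed

text \<open>By independence the expectation of the product of exponentials factors. Complex
  \<open>z\<close> serves two uses: real values for the growth bounds, imaginary ones for the
  characteristic function.\<close>

lemma has_bochner_integral_exp_sum_\<xi>:
  fixes z :: complex
  assumes "finite I" and z: "\<And>k. k \<in> I \<Longrightarrow> \<bar>Re z\<bar> < 2 * real (Suc k) * pi"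
  shows "has_bochner_integral M (\<lambda>\<omega>. exp (z * of_real (\<Sum>k\<in>I. \<xi> k \<omega>)))
    (\<Prod>k\<in>I. 1 / (1 - (z / of_real (2 * real (Suc k) * pi))\<^sup>2))"
proof -
  \<comment> \<open>\<open>G\<close> keeps the indexing of \<open>X\<close> from 1, for which
    independence is assumed; \<open>I\<close> is shifted by \<open>Suc\<close> to match.\<close>
  define G where "G j \<omega> = exp (z * of_real (X j \<omega> / (2 * real j * pi)))" for j \<omega>
  have G: "G (Suc k) = (\<lambda>\<omega>. exp (z * of_real (\<xi> k \<omega>)))" for k
    by (simp add: G_def \<xi>_def fun_eq_iff)
  have "indep_vars (\<lambda>_. borel) G {1..}"
    unfolding G_def[abs_def] by (rule indep_vars_compose2[OF indep]) measurable
  then have ind: "indep_vars (\<lambda>_. borel) G (Suc ` I)"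
    by (rule indep_vars_subset) auto
  have int: "integrable M (G j)" if "j \<in> Suc ` I" for j
    using that has_bochner_integral_exp_\<xi>[OF z] by (auto simp: G has_bochner_integral_iff)
  have prod: "(\<Prod>j\<in>Suc ` I. G j \<omega>) = exp (z * of_real (\<Sum>k\<in>I. \<xi> k \<omega>))" for \<omega>
    using \<open>finite I\<close> by (simp add: prod.reindex G exp_sum sum_distrib_left)
  have "integrable M (\<lambda>\<omega>. \<Prod>j\<in>Suc ` I. G j \<omega>)"
    using \<open>finite I\<close> ind int by (intro indep_vars_integrable) auto
  moreover have "expectation (\<lambda>\<omega>. \<Prod>j\<in>Suc ` I. G j \<omega>) = (\<Prod>j\<in>Suc ` I. expectation (G j))"
    using \<open>finite I\<close> ind int by (intro indep_vars_lebesgue_integral) auto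
  moreover have "(\<Prod>j\<in>Suc ` I. expectation (G j))
      = (\<Prod>k\<in>I. 1 / (1 - (z / of_real (2 * real (Suc k) * pi))\<^sup>2))"
    unfolding prod.reindex[OF inj_Suc] comp_def
    using has_bochner_integral_exp_\<xi>[OF z]
    by (intro prod.cong refl) (simp add: G has_bochner_integral_iff)
  ultimately show ?thesis unfolding prod by (simp add: has_bochner_integral_iff)
qed

section \<open>Uniform exponential bounds for increments and tails\<close>

text \<open>\<open>S m - S n\<close> has variance of order at most \<open>1 / (n + 1)\<close>, so
  this \<open>t\<close> is the natural scale for a bound uniform in \<open>m\<close> and
  \<open>n\<close>. Fixing only \<open>t\<^sup>2\<close> admits both signs, as cosh
  requires.\<close>

lemma exp_increment_bound:
  assumes "n \<le> m" and t: "t\<^sup>2 = real n + 1"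
  shows "integrable M (\<lambda>\<omega>. exp (t * (S m \<omega> - S n \<omega>)))"
    and "expectation (\<lambda>\<omega>. exp (t * (S m \<omega> - S n \<omega>))) \<le> 2"
proof -
  define b where "b k = (t / (2 * real (Suc k) * pi))\<^sup>2" for k
  \<comment> \<open>From \<open>pi > 3\<close>; squaring 6 yields the constant 36 below.\<close>
  have "6 * real (Suc k) \<le> 2 * real (Suc k) * pi" for k
    using mult_left_mono[OF less_imp_le[OF pi_gt3], of "2 * real (Suc k)"] by simp
  then have b: "b k \<le> t\<^sup>2 / 36 * (1 / (real k + 1)\<^sup>2)" for k
  proof -
    have "b k \<le> t\<^sup>2 / (6 * real (Suc k))\<^sup>2"
      unfolding b_def power_divide using \<open>6 * real (Suc k) \<le> 2 * real (Suc k) * pi\<close>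
      by (intro divide_left_mono power_mono mult_pos_pos) auto
    then show ?thesis unfolding power_mult_distrib by (simp add: add.commute)
  qed
  have sb: "(\<Sum>k=n..<m. b k) \<le> 1 / 18"
  proof -
    have "(\<Sum>k=n..<m. b k) \<le> t\<^sup>2 / 36 * (\<Sum>k=n..<m. 1 / (real k + 1)\<^sup>2)"
      unfolding sum_distrib_left by (intro sum_mono b)
    also have "\<dots> \<le> t\<^sup>2 / 36 * (2 / (real n + 1))"
      by (intro mult_left_mono sum_inverse_squares_le) auto
    also have "\<dots> = 1 / 18" unfolding t by (simp add: field_simps)
    finally show ?thesis .
  qed
  have b0: "0 \<le> b k" for k by (simp add: b_def)
  \<comment> \<open>This places \<open>t\<close> inside the strip on which the exponential moment of
    \<open>\<xi> k\<close> is finite.\<close>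
  have b1: "b k < 1" if "k \<in> {n..<m}" for k
  proof -
    have "b k \<le> (\<Sum>k=n..<m. b k)" using that b0 by (intro member_le_sum) auto
    with sb show ?thesis by linarith
  qed
  have diff: "S m \<omega> - S n \<omega> = (\<Sum>k=n..<m. \<xi> k \<omega>)" for \<omega>
    using assms(1) by (simp add: S_def lessThan_atLeast0 sum_diff_nat_ivl)
  have "has_bochner_integral M (\<lambda>\<omega>. exp (complex_of_real t * of_real (\<Sum>k=n..<m. \<xi> k \<omega>)))
    (\<Prod>k=n..<m. 1 / (1 - (complex_of_real t / of_real (2 * real (Suc k) * pi))\<^sup>2))"
  proof (rule has_bochner_integral_exp_sum_\<xi>)
    fix k assume "k \<in> {n..<m}"
    from b1[OF this] have "\<bar>t / (2 * real (Suc k) * pi)\<bar> < 1"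
      unfolding b_def by (simp only: abs_square_less_1)
    then show "\<bar>Re (complex_of_real t)\<bar> < 2 * real (Suc k) * pi"
      by (simp add: abs_divide)
  qed simp
  also have "(\<lambda>\<omega>. exp (complex_of_real t * of_real (\<Sum>k=n..<m. \<xi> k \<omega>)))
      = (\<lambda>\<omega>. complex_of_real (exp (t * (S m \<omega> - S n \<omega>))))"
    by (simp add: diff exp_of_real[symmetric])
  also have "(\<Prod>k=n..<m. 1 / (1 - (complex_of_real t / of_real (2 * real (Suc k) * pi))\<^sup>2))
      = complex_of_real (\<Prod>k=n..<m. 1 / (1 - b k))"
    by (simp add: b_def)
  finally have *: "has_bochner_integral M (\<lambda>\<omega>. complex_of_real (exp (t * (S m \<omega> - S n \<omega>))))
      (complex_of_real (\<Prod>k=n..<m. 1 / (1 - b k)))" .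
  then show "integrable M (\<lambda>\<omega>. exp (t * (S m \<omega> - S n \<omega>)))"
    unfolding has_bochner_integral_iff by (simp only: complex_of_real_integrable_eq)
  have "expectation (\<lambda>\<omega>. exp (t * (S m \<omega> - S n \<omega>))) = (\<Prod>k=n..<m. 1 / (1 - b k))"
    using * unfolding has_bochner_integral_iff integral_complex_of_real of_real_eq_iff by blast
  also have "\<dots> = 1 / (\<Prod>k=n..<m. 1 - b k)" by (simp add: prod_dividef)
  \<comment> \<open>The product is at least 1 - 1/18; the cruder lower bound 1/2 suffices.\<close>
  also have "\<dots> \<le> 2"
  proof -
    have "1 - (\<Sum>k=n..<m. b k) \<le> (\<Prod>k=n..<m. 1 - b k)"
      using b0 b1 by (intro one_minus_sum_le_prod) (auto intro: less_imp_le)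
    with sb have "(\<Prod>k=n..<m. 1 - b k) \<ge> 1 / 2" by linarith
    then show ?thesis by (simp add: divide_simps)
  qed
  finally show "expectation (\<lambda>\<omega>. exp (t * (S m \<omega> - S n \<omega>))) \<le> 2" .
qed

text \<open>Average of the exponential bounds for \<open>t\<close> and \<open>- t\<close>. The
  nonnegative integral is the form to which Fatou's lemma applies.\<close>

lemma cosh_increment_bound:
  assumes "n \<le> m"
  shows "(\<integral>\<^sup>+ \<omega>. ennreal (cosh (sqrt (real n + 1) * (S m \<omega> - S n \<omega>))) \<partial>M) \<le> 2"
proof -
  define t where "t = sqrt (real n + 1)"
  have t: "t\<^sup>2 = real n + 1" "(- t)\<^sup>2 = real n + 1" by (auto simp: t_def)
  note 1 = exp_increment_bound[OF assms t(1)] and 2 = exp_increment_bound[OF assms t(2)]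
  have cosh: "cosh (t * x) = (exp (t * x) + exp (- t * x)) / 2" for x
    by (simp add: cosh_field_def)
  have int: "integrable M (\<lambda>\<omega>. cosh (t * (S m \<omega> - S n \<omega>)))"
    unfolding cosh using 1(1) 2(1) by simp
  then have "(\<integral>\<^sup>+ \<omega>. ennreal (cosh (t * (S m \<omega> - S n \<omega>))) \<partial>M)
      = ennreal (expectation (\<lambda>\<omega>. cosh (t * (S m \<omega> - S n \<omega>))))"
    by (intro nn_integral_eq_integral) (auto simp: cosh_real_nonneg)
  also have "expectation (\<lambda>\<omega>. cosh (t * (S m \<omega> - S n \<omega>))) \<le> 2"
    unfolding cosh using 1 2 by simp
  finally show ?thesis by (simp add: t_def ennreal_leI)
qed

text \<open>Fatou's lemma carries the increment bound to the limit. A general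
  \<open>\<sigma>\<close> allows use along \<open>4 ^ k\<close> first, and along all indices once
  full convergence is known.\<close>

lemma cosh_tail_bound:
  assumes lim: "AE \<omega> in M. (\<lambda>k. S (\<sigma> k) \<omega>) \<longlonglongrightarrow> L \<omega>" and \<sigma>: "filterlim \<sigma> at_top sequentially"
  shows "(\<integral>\<^sup>+ \<omega>. ennreal (cosh (sqrt (real n + 1) * (L \<omega> - S n \<omega>))) \<partial>M) \<le> 2"
proof -
  let ?u = "\<lambda>k \<omega>. ennreal (cosh (sqrt (real n + 1) * (S (\<sigma> k) \<omega> - S n \<omega>)))"
  have [measurable]: "?u k \<in> borel_measurable M" for k
    unfolding cosh_field_def by measurable
  have "(\<integral>\<^sup>+ \<omega>. ennreal (cosh (sqrt (real n + 1) * (L \<omega> - S n \<omega>))) \<partial>M)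
      = (\<integral>\<^sup>+ \<omega>. liminf (\<lambda>k. ?u k \<omega>) \<partial>M)"
  proof (rule nn_integral_cong_AE)
    show "AE \<omega> in M. ennreal (cosh (sqrt (real n + 1) * (L \<omega> - S n \<omega>))) = liminf (\<lambda>k. ?u k \<omega>)"
      using lim
    proof eventually_elim
      case (elim \<omega>)
      then have "(\<lambda>k. ?u k \<omega>) \<longlonglongrightarrow> ennreal (cosh (sqrt (real n + 1) * (L \<omega> - S n \<omega>)))"
        by (intro tendsto_intros)
      then show ?case by (intro lim_imp_Liminf[symmetric]) auto
    qed
  qed
  also have "\<dots> \<le> liminf (\<lambda>k. \<integral>\<^sup>+ \<omega>. ?u k \<omega> \<partial>M)"
    by (rule nn_integral_liminf) measurable
  also have "\<dots> \<le> liminf (\<lambda>k. 2)"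
  proof (rule Liminf_mono)
    have "eventually (\<lambda>k. \<sigma> k \<ge> n) sequentially"
      using \<sigma> by (auto simp: filterlim_at_top)
    then show "eventually (\<lambda>k. (\<integral>\<^sup>+ \<omega>. ?u k \<omega> \<partial>M) \<le> 2) sequentially"
      by eventually_elim (rule cosh_increment_bound)
  qed
  also have "\<dots> = 2" by (simp add: Liminf_const)
  finally show ?thesis .
qed

section \<open>Almost sure convergence of the series\<close>

text \<open>Increments from index \<open>n\<close> on have mean absolute value of order
  \<open>1 / sqrt n\<close>, hence \<open>1 / 2 ^ k\<close> at \<open>n = 4 ^ k\<close>. So the
  increments are almost surely absolutely summable, and they telescope.\<close>

lemma AE_convergent_subseq: "AE \<omega> in M. convergent (\<lambda>k. S (4 ^ k) \<omega>)"
proof -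
  define D where "D k \<omega> = S (4 ^ Suc k) \<omega> - S (4 ^ k) \<omega>" for k \<omega>
  have [measurable]: "D k \<in> borel_measurable M" for k
    unfolding D_def[abs_def] by measurable
  have bound: "(\<integral>\<^sup>+ \<omega>. ennreal \<bar>D k \<omega>\<bar> \<partial>M) \<le> ennreal (4 * (1/2) ^ k)" for k
  proof -
    let ?s = "sqrt (real (4 ^ k) + 1)"
    have s: "2 ^ k \<le> ?s"
    proof (rule real_le_rsqrt)
      have "(2 ^ k)\<^sup>2 = (4 ^ k :: real)" by (simp add: power2_eq_square flip: power_mult_distrib)
      then show "(2 ^ k)\<^sup>2 \<le> real (4 ^ k) + 1" by simp
    qed
    have "\<bar>D k \<omega>\<bar> \<le> 2 * (1/2) ^ k * cosh (?s * D k \<omega>)" for \<omega>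
    proof -
      have "2 ^ k * \<bar>D k \<omega>\<bar> \<le> ?s * \<bar>D k \<omega>\<bar>" using s by (intro mult_right_mono) auto
      also have "\<dots> \<le> 2 * cosh (?s * D k \<omega>)"
        using abs_power_le_cosh[of "?s * D k \<omega>" 1] by (simp add: abs_mult)
      finally show ?thesis by (simp add: field_simps power_divide)
    qed
    then have "(\<integral>\<^sup>+ \<omega>. ennreal \<bar>D k \<omega>\<bar> \<partial>M) \<le> (\<integral>\<^sup>+ \<omega>. ennreal (2 * (1/2) ^ k) * ennreal (cosh (?s * D k \<omega>)) \<partial>M)"
      by (intro nn_integral_mono) (simp add: ennreal_mult[symmetric] ennreal_leI)
    also have "\<dots> = ennreal (2 * (1/2) ^ k) * (\<integral>\<^sup>+ \<omega>. ennreal (cosh (?s * D k \<omega>)) \<partial>M)"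
      unfolding cosh_field_def by (rule nn_integral_cmult) measurable
    also have "\<dots> \<le> ennreal (2 * (1/2) ^ k) * 2"
      unfolding D_def by (intro mult_left_mono cosh_increment_bound) auto
    also have "\<dots> = ennreal (4 * (1/2) ^ k)"
      by (simp add: ennreal_mult'[symmetric] flip: ennreal_numeral)
    finally show ?thesis .
  qed
  have "(\<integral>\<^sup>+ \<omega>. (\<Sum>k. ennreal \<bar>D k \<omega>\<bar>) \<partial>M) = (\<Sum>k. \<integral>\<^sup>+ \<omega>. ennreal \<bar>D k \<omega>\<bar> \<partial>M)"
    by (rule nn_integral_suminf) measurable
  also have "\<dots> \<le> (\<Sum>k. ennreal (4 * (1/2) ^ k))"
    by (intro suminf_le bound) auto
  also have "\<dots> < \<infinity>"
    by (subst suminf_ennreal2) (auto intro!: summable_mult summable_geometric)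
  finally have "AE \<omega> in M. (\<Sum>k. ennreal \<bar>D k \<omega>\<bar>) \<noteq> \<infinity>"
    by (intro nn_integral_PInf_AE) auto
  then show ?thesis
  proof eventually_elim
    case (elim \<omega>)
    then have "summable (\<lambda>k. \<bar>D k \<omega>\<bar>)"
      by (intro summable_suminf_not_top) auto
    then have "summable (\<lambda>k. D k \<omega>)" by (rule summable_rabs_cancel)
    then have "convergent (\<lambda>n. \<Sum>k<n. D k \<omega>)" by (simp add: summable_iff_convergent)
    then have "convergent (\<lambda>n. (\<Sum>k<n. D k \<omega>) + S (4 ^ 0) \<omega>)"
      by (intro convergent_add convergent_const)
    then show ?case
      unfolding D_def by (subst (asm) sum_lessThan_telescope) simp
  qed
qed

text \<open>The fourth power is taken because its tail bound \<open>1 / n\<^sup>2\<close> is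
  summable over all \<open>n\<close>, while the bound \<open>1 / n\<close> for squares is not.
  Almost surely the fourth powers are then summable, so they tend to 0.\<close>

lemma AE_summable_\<xi>: "AE \<omega> in M. summable (\<lambda>k. \<xi> k \<omega>)"
proof -
  \<comment> \<open>\<open>lim\<close> is meaningful only where the subsequence converges, which is
    almost everywhere.\<close>
  define L where "L \<omega> = lim (\<lambda>k. S (4 ^ k) \<omega>)" for \<omega>
  have [measurable]: "L \<in> borel_measurable M" unfolding L_def[abs_def] by measurable
  have L: "AE \<omega> in M. (\<lambda>k. S (4 ^ k) \<omega>) \<longlonglongrightarrow> L \<omega>"
    using AE_convergent_subseq unfolding L_def by (simp add: convergent_LIMSEQ_iff)
  have pow: "filterlim (\<lambda>k. 4 ^ k :: nat) at_top sequentially"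
    by (rule filterlim_subseq) (auto intro!: strict_monoI)
  have bound: "(\<integral>\<^sup>+ \<omega>. ennreal ((L \<omega> - S n \<omega>) ^ 4) \<partial>M) \<le> ennreal (96 * (1 / (real n + 1)\<^sup>2))" for n
  proof -
    \<comment> \<open>48 is \<open>2 * fact 4\<close> from \<open>abs_power_le_cosh\<close>; the
      bound 2 on the cosh integral doubles it to 96.\<close>
    let ?s = "sqrt (real n + 1)" and ?c = "48 * (1 / (real n + 1)\<^sup>2)"
    have s4: "?s ^ 4 = (real n + 1)\<^sup>2"
      using power_mult[of ?s 2 2] by simp
    have "(L \<omega> - S n \<omega>) ^ 4 \<le> ?c * cosh (?s * (L \<omega> - S n \<omega>))" for \<omega>
      using abs_power_le_cosh[of "?s * (L \<omega> - S n \<omega>)" 4]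
      unfolding power_even_abs[OF even_numeral] power_mult_distrib s4
      by (simp add: fact_numeral pos_le_divide_eq mult.commute)
    then have "(\<integral>\<^sup>+ \<omega>. ennreal ((L \<omega> - S n \<omega>) ^ 4) \<partial>M)
        \<le> (\<integral>\<^sup>+ \<omega>. ennreal ?c * ennreal (cosh (?s * (L \<omega> - S n \<omega>))) \<partial>M)"
      by (intro nn_integral_mono) (simp add: ennreal_mult[symmetric] ennreal_leI)
    also have "\<dots> = ennreal ?c * (\<integral>\<^sup>+ \<omega>. ennreal (cosh (?s * (L \<omega> - S n \<omega>))) \<partial>M)"
      unfolding cosh_field_def by (rule nn_integral_cmult) measurable
    also have "\<dots> \<le> ennreal ?c * 2"
      by (intro mult_left_mono cosh_tail_bound[OF L pow]) auto
    also have "\<dots> = ennreal (96 * (1 / (real n + 1)\<^sup>2))"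
      by (simp add: ennreal_mult'[symmetric] flip: ennreal_numeral)
    finally show ?thesis .
  qed
  have "summable (\<lambda>n. 1 / (real n + 1)\<^sup>2)"
    using inverse_power_summable[of 2, where ?'a = real]
      summable_Suc_iff[of "\<lambda>n. inverse (real n ^ 2)"] by (simp add: inverse_eq_divide add.commute)
  then have fin: "(\<Sum>n. ennreal (96 * (1 / (real n + 1)\<^sup>2))) < \<infinity>"
    by (subst suminf_ennreal2) (auto intro!: summable_mult simp del: times_divide_eq_right)
  have "(\<integral>\<^sup>+ \<omega>. (\<Sum>n. ennreal ((L \<omega> - S n \<omega>) ^ 4)) \<partial>M) = (\<Sum>n. \<integral>\<^sup>+ \<omega>. ennreal ((L \<omega> - S n \<omega>) ^ 4) \<partial>M)"
    by (rule nn_integral_suminf) measurable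
  also have "\<dots> \<le> (\<Sum>n. ennreal (96 * (1 / (real n + 1)\<^sup>2)))"
    by (intro suminf_le bound) auto
  also note fin
  finally have "AE \<omega> in M. (\<Sum>n. ennreal ((L \<omega> - S n \<omega>) ^ 4)) \<noteq> \<infinity>"
    by (intro nn_integral_PInf_AE) auto
  then show ?thesis
  proof eventually_elim
    case (elim \<omega>)
    then have "summable (\<lambda>n. (L \<omega> - S n \<omega>) ^ 4)"
      by (intro summable_suminf_not_top) auto
    then have "(\<lambda>n. (L \<omega> - S n \<omega>) ^ 4) \<longlonglongrightarrow> 0" by (rule summable_LIMSEQ_zero)
    then have "(\<lambda>n. root 4 ((L \<omega> - S n \<omega>) ^ 4)) \<longlonglongrightarrow> root 4 0" by (intro tendsto_intros)
    then have "(\<lambda>n. \<bar>L \<omega> - S n \<omega>\<bar>) \<longlonglongrightarrow> 0"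
      using root_abs_power[of 4 "L \<omega> - S _ \<omega>"] by (simp add: power_even_abs)
    then have "(\<lambda>n. L \<omega> - (L \<omega> - S n \<omega>)) \<longlonglongrightarrow> L \<omega> - 0"
      by (intro tendsto_intros) (simp add: tendsto_rabs_zero_iff)
    then have "(\<lambda>k. \<xi> k \<omega>) sums L \<omega>" by (simp add: sums_def S_def)
    then show ?case by (rule sums_summable)
  qed
qed

section \<open>The sum of the series and its moment bounds\<close>

text \<open>Off the almost sure set of summability, \<open>suminf\<close> carries no meaning as a
  limit; expectations do not see this.\<close>

definition Y :: "'a \<Rightarrow> real" where
  "Y \<omega> = (\<Sum>k. \<xi> k \<omega>)"

lemma measurable_Y [measurable]: "Y \<in> borel_measurable M"
  unfolding Y_def[abs_def] by measurable

lemma AE_S_tendsto_Y: "AE \<omega> in M. (\<lambda>n. S n \<omega>) \<longlonglongrightarrow> Y \<omega>"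
  using AE_summable_\<xi> unfolding S_def Y_def by eventually_elim (rule summable_LIMSEQ)

lemma integrable_cosh_Y: "integrable M (\<lambda>\<omega>. cosh (Y \<omega>))"
  and expectation_cosh_Y: "expectation (\<lambda>\<omega>. cosh (Y \<omega>)) \<le> 2"
proof -
  have [measurable]: "(\<lambda>\<omega>. cosh (Y \<omega>)) \<in> borel_measurable M"
    unfolding cosh_field_def by measurable
  \<comment> \<open>The tail bound at \<open>n = 0\<close>, where \<open>S 0 = 0\<close> and the
    scale is 1.\<close>
  have le: "(\<integral>\<^sup>+ \<omega>. ennreal (cosh (Y \<omega>)) \<partial>M) \<le> 2"
    using cosh_tail_bound[OF AE_S_tendsto_Y filterlim_ident, of 0] by (simp add: S_def)
  show int: "integrable M (\<lambda>\<omega>. cosh (Y \<omega>))"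
    using le_less_trans[OF le, of \<infinity>] by (intro integrableI_nonneg) (auto simp: cosh_real_nonneg)
  have "ennreal (expectation (\<lambda>\<omega>. cosh (Y \<omega>))) \<le> ennreal 2"
    using le nn_integral_eq_integral[OF int] by (simp add: cosh_real_nonneg)
  then show "expectation (\<lambda>\<omega>. cosh (Y \<omega>)) \<le> 2" by (subst (asm) ennreal_le_iff) auto
qed

text \<open>Growth no faster than \<open>fact n\<close> is what makes the expansions of the cosine
  and sine transforms converge for \<open>\<bar>t\<bar> < 1\<close>.\<close>

lemma integrable_Y_power: "integrable M (\<lambda>\<omega>. Y \<omega> ^ n)"
  and expectation_abs_Y_power: "expectation (\<lambda>\<omega>. \<bar>Y \<omega>\<bar> ^ n) \<le> 4 * fact n"
proof -
  have bound: "\<bar>Y \<omega>\<bar> ^ n \<le> 2 * fact n * cosh (Y \<omega>)" for \<omega> by (rule abs_power_le_cosh)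
  have int: "integrable M (\<lambda>\<omega>. 2 * fact n * cosh (Y \<omega>))"
    using integrable_cosh_Y by simp
  show *: "integrable M (\<lambda>\<omega>. Y \<omega> ^ n)"
    by (rule Bochner_Integration.integrable_bound[OF int]) (use bound in \<open>auto simp: power_abs cosh_real_nonneg\<close>)
  have "expectation (\<lambda>\<omega>. \<bar>Y \<omega>\<bar> ^ n) \<le> expectation (\<lambda>\<omega>. 2 * fact n * cosh (Y \<omega>))"
    using integrable_abs[OF *] by (intro integral_mono int bound) (simp add: power_abs)
  also have "\<dots> \<le> 2 * fact n * 2"
    using expectation_cosh_Y by simp
  finally show "expectation (\<lambda>\<omega>. \<bar>Y \<omega>\<bar> ^ n) \<le> 4 * fact n" by simp
qed

section \<open>Characteristic function through Euler's sine product\<close>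

text \<open>The characteristic function of \<open>S n\<close> is the reciprocal of the
  \<open>n\<close>-th partial sine product. The product form of the identity avoids dividing by 0 at
  \<open>t = 0\<close>.\<close>

lemma char_Y: "expectation (\<lambda>\<omega>. exp (\<i> * of_real (t * Y \<omega>))) * of_real (exp (t/2) - exp (- (t/2))) = of_real t"
proof -
  \<comment> \<open>Chosen so that \<open>z / k\<close> is the argument in the transform of the
    \<open>k\<close>-th summand, while \<open>pi * z = \<i> * t / 2\<close>.\<close>
  define z where "z = \<i> * of_real t / (2 * of_real pi)"
  define P where "P n = (\<Prod>k=1..n. 1 - z\<^sup>2 / of_nat k ^ 2)" for n
  define \<phi> where "\<phi> n = expectation (\<lambda>\<omega>. exp (\<i> * of_real (t * S n \<omega>)))" for n
  have \<phi>: "\<phi> \<longlonglongrightarrow> expectation (\<lambda>\<omega>. exp (\<i> * of_real (t * Y \<omega>)))"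
    unfolding \<phi>_def
  proof (rule integral_dominated_convergence[where w = "\<lambda>_. 1"])
    show "AE \<omega> in M. (\<lambda>n. exp (\<i> * of_real (t * S n \<omega>))) \<longlonglongrightarrow> exp (\<i> * of_real (t * Y \<omega>))"
      using AE_S_tendsto_Y by eventually_elim (intro tendsto_intros)
  qed auto
  have P_mult: "\<phi> n * P n = 1" for n
  proof -
    let ?f = "\<lambda>k. 1 - (\<i> * of_real t / complex_of_real (2 * real (Suc k) * pi))\<^sup>2"
    \<comment> \<open>Squaring the imaginary unit flips the sign, so each factor is at least 1 and
      in particular nonzero.\<close>
    have f: "?f k = of_real (1 + (t / (2 * real (Suc k) * pi))\<^sup>2)" for k
      by (simp add: power_mult_distrib power_divide)
    have nz: "?f k \<noteq> 0" for k
      unfolding f of_real_eq_0_iff using zero_le_power2[of "t / (2 * real (Suc k) * pi)"] by linarith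
    have "P n = (\<Prod>k<n. 1 - z\<^sup>2 / of_nat (Suc k) ^ 2)"
      unfolding P_def by (simp add: prod.atLeast1_atMost_eq)
    also have "\<dots> = (\<Prod>k<n. ?f k)"
      unfolding z_def power_divide[symmetric] by (intro prod.cong refl) (simp add: mult_ac)
    finally have P: "P n = (\<Prod>k<n. ?f k)" .
    have "\<phi> n = (\<Prod>k<n. 1 / ?f k)"
      using has_bochner_integral_exp_sum_\<xi>[of "{..<n}" "\<i> * of_real t"]
      by (simp add: \<phi>_def S_def has_bochner_integral_iff mult.assoc)
    moreover have inv: "1 / w * w = 1" if "w \<noteq> 0" for w :: complex
      using that by simp
    ultimately have "\<phi> n * P n = (\<Prod>k<n. 1 / ?f k * ?f k)" by (simp only: P prod.distrib)
    also have "\<dots> = 1" by (intro prod.neutral ballI inv nz)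
    finally show ?thesis .
  qed
  have "(\<lambda>n. \<phi> n * (of_real pi * z * P n)) \<longlonglongrightarrow>
      expectation (\<lambda>\<omega>. exp (\<i> * of_real (t * Y \<omega>))) * sin (of_real pi * z)"
    unfolding P_def by (intro tendsto_mult \<phi> sin_product_formula_complex)
  moreover have "\<phi> n * (of_real pi * z * P n) = of_real pi * z" for n
    using P_mult[of n] by (simp add: mult_ac)
  ultimately have "expectation (\<lambda>\<omega>. exp (\<i> * of_real (t * Y \<omega>))) * sin (of_real pi * z) = of_real pi * z"
    by (simp add: LIMSEQ_const_iff)
  moreover have "of_real pi * z = \<i> * of_real t / 2" by (simp add: z_def)
  moreover have "sin (\<i> * of_real t / 2) = \<i> * of_real (exp (t/2) - exp (- (t/2))) / 2"
    by (simp add: sin_exp_eq exp_of_real[symmetric] field_simps)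
  ultimately show ?thesis by simp
qed

lemma expectation_cos_Y: "expectation (\<lambda>\<omega>. cos (t * Y \<omega>)) * (exp (t/2) - exp (- (t/2))) = t"
  and expectation_sin_Y: "expectation (\<lambda>\<omega>. sin (t * Y \<omega>)) * (exp (t/2) - exp (- (t/2))) = 0"
proof -
  let ?E = "expectation (\<lambda>\<omega>. exp (\<i> * of_real (t * Y \<omega>)))"
  have int: "integrable M (\<lambda>\<omega>. exp (\<i> * of_real (t * Y \<omega>)))"
    by (rule integrable_const_bound[where B = 1]) auto
  have Re: "Re ?E = expectation (\<lambda>\<omega>. cos (t * Y \<omega>))"
    using integral_Re[OF int] by (simp add: Re_exp)
  have Im: "Im ?E = expectation (\<lambda>\<omega>. sin (t * Y \<omega>))"
    using integral_Im[OF int] by (simp add: Im_exp)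
  note char = char_Y[of t]
  show "expectation (\<lambda>\<omega>. cos (t * Y \<omega>)) * (exp (t/2) - exp (- (t/2))) = t"
    using arg_cong[OF char, of Re] unfolding Re[symmetric] by simp
  show "expectation (\<lambda>\<omega>. sin (t * Y \<omega>)) * (exp (t/2) - exp (- (t/2))) = 0"
    using arg_cong[OF char, of Im] unfolding Im[symmetric] by simp
qed

section \<open>Moments as power series coefficients\<close>

text \<open>Sum and expectation may be exchanged because the absolute terms have expectation at most
  \<open>4 * \<bar>t\<bar> ^ n\<close>. General \<open>c\<close> covers cosine and sine
  alike.\<close>

lemma expectation_powser_Y:
  fixes c :: "nat \<Rightarrow> real"
  assumes c: "\<And>n. \<bar>c n\<bar> \<le> 1 / fact n" and t: "\<bar>t\<bar> < 1"
    and f: "\<And>x. (\<lambda>n. c n * x ^ n) sums f x"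
  shows "(\<lambda>n. c n * expectation (\<lambda>\<omega>. Y \<omega> ^ n) * t ^ n) sums expectation (\<lambda>\<omega>. f (t * Y \<omega>))"
proof -
  let ?g = "\<lambda>n \<omega>. c n * (t * Y \<omega>) ^ n"
  have int: "integrable M (?g n)" for n
    unfolding power_mult_distrib using integrable_Y_power[of n] by simp
  have "(\<lambda>n. integral\<^sup>L M (?g n)) sums (\<integral>\<omega>. (\<Sum>n. ?g n \<omega>) \<partial>M)"
  proof (rule sums_integral[OF int])
    show "AE \<omega> in M. summable (\<lambda>n. norm (?g n \<omega>))"
    proof (rule AE_I2)
      fix \<omega>
      show "summable (\<lambda>n. norm (?g n \<omega>))"
      proof (rule summable_comparison_test'[OF summable_exp[of "\<bar>t * Y \<omega>\<bar>"]])
        show "norm (norm (?g n \<omega>)) \<le> inverse (fact n) * \<bar>t * Y \<omega>\<bar> ^ n" for n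
          using mult_right_mono[OF c[of n], of "\<bar>t * Y \<omega>\<bar> ^ n"]
          by (simp add: abs_mult power_abs inverse_eq_divide)
      qed
    qed
    show "summable (\<lambda>n. \<integral>\<omega>. norm (?g n \<omega>) \<partial>M)"
    proof (rule summable_comparison_test')
      show "summable (\<lambda>n. 4 * \<bar>t\<bar> ^ n)"
        using t by (intro summable_mult summable_geometric) auto
      fix n
      have "(\<integral>\<omega>. norm (?g n \<omega>) \<partial>M) = \<bar>c n\<bar> * \<bar>t\<bar> ^ n * expectation (\<lambda>\<omega>. \<bar>Y \<omega>\<bar> ^ n)"
        by (simp add: abs_mult power_mult_distrib power_abs mult.assoc)
      also have "\<dots> \<le> 1 / fact n * \<bar>t\<bar> ^ n * (4 * fact n)"
        by (intro mult_mono c expectation_abs_Y_power) auto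
      finally show "norm (\<integral>\<omega>. norm (?g n \<omega>) \<partial>M) \<le> 4 * \<bar>t\<bar> ^ n" by simp
    qed
  qed
  moreover have "(\<Sum>n. ?g n \<omega>) = f (t * Y \<omega>)" for \<omega>
    using f by (rule sums_unique[symmetric])
  ultimately show ?thesis by (simp add: power_mult_distrib mult_ac)
qed

text \<open>The sine transform vanishes near 0, so all its coefficients do, and
  \<open>sin_coeff n\<close> is nonzero for odd \<open>n\<close>.\<close>

lemma moment_Y_odd:
  assumes "odd n"
  shows "expectation (\<lambda>\<omega>. Y \<omega> ^ n) = 0"
proof -
  have "sin_coeff n * expectation (\<lambda>\<omega>. Y \<omega> ^ n) = 0"
  proof (rule powser_eq_0_imp_coeff_0[of 1 "\<lambda>n. sin_coeff n * expectation (\<lambda>\<omega>. Y \<omega> ^ n)"])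
    fix t :: real assume t: "norm t < 1"
    \<comment> \<open>For \<open>t \<noteq> 0\<close> the factor
      \<open>exp (t/2) - exp (- (t/2))\<close> is nonzero and cancels; at \<open>t = 0\<close> the
      sine itself is 0.\<close>
    have "expectation (\<lambda>\<omega>. sin (t * Y \<omega>)) = 0"
      using expectation_sin_Y[of t] by (cases "t = 0") auto
    then show "(\<lambda>n. sin_coeff n * expectation (\<lambda>\<omega>. Y \<omega> ^ n) * t ^ n) sums 0"
      using expectation_powser_Y[of sin_coeff t sin] abs_sin_coeff_le t
        sin_converges[where ?'a = real] by simp
  qed simp
  then show ?thesis using assms by (simp add: sin_coeff_def)
qed

text \<open>The cosine identity on \<open>\<bar>t\<bar> < 1\<close> becomes an identity of formal
  series by uniqueness of coefficients. The factor \<open>fact n * cos_coeff n\<close> is the sign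
  \<open>(-1) ^ (n div 2)\<close> for even \<open>n\<close> and 0 for odd \<open>n\<close>.\<close>

lemma moment_Y:
  "fact n * cos_coeff n * expectation (\<lambda>\<omega>. Y \<omega> ^ n)
    = real n / 2 ^ n * euler_num (n - 1) + bernoulli_num n"
proof -
  define F where "F = Abs_fps (\<lambda>n. cos_coeff n * expectation (\<lambda>\<omega>. Y \<omega> ^ n))"
  define H :: "real fps" where "H = F * (fps_exp (1/2) - fps_exp (-(1/2))) - fps_X"
  have F: "(\<lambda>n. fps_nth F n * t ^ n) sums expectation (\<lambda>\<omega>. cos (t * Y \<omega>))" if "\<bar>t\<bar> < 1" for t
    using expectation_powser_Y[of cos_coeff t cos] abs_cos_coeff_le that
      cos_converges[where ?'a = real] by (simp add: F_def)
  \<comment> \<open>The radii are needed because \<open>eval_fps\<close> respects products and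
    differences only inside the discs of convergence.\<close>
  have rad: "fps_conv_radius F \<ge> 1"
    unfolding fps_conv_radius_def
    by (rule conv_radius_geI_ex') (auto intro!: sums_summable[OF F])
  let ?d = "fps_exp (1/2) - fps_exp (-(1/2)) :: real fps"
  have rad_d: "fps_conv_radius ?d = \<infinity>"
    using fps_conv_radius_diff[of "fps_exp (1/2)" "fps_exp (-(1/2)) :: real fps"] by simp
  have rad_Fd: "fps_conv_radius (F * ?d) \<ge> 1"
    using fps_conv_radius_mult[of F ?d] rad rad_d by simp
  have rad_H: "fps_conv_radius H \<ge> 1"
    using fps_conv_radius_diff[of "F * ?d" fps_X] rad_Fd by (simp add: H_def)
  have "H = 0"
  proof (rule fps_ext)
    fix n
    have "fps_nth H n = 0"
    proof (rule powser_eq_0_imp_coeff_0[of 1 "fps_nth H"])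
      fix t :: real assume t: "norm t < 1"
      then have lt: "ereal (norm t) < fps_conv_radius F" "ereal (norm t) < fps_conv_radius H"
        "ereal (norm t) < fps_conv_radius (F * ?d)" "ereal (norm t) < fps_conv_radius ?d"
        using rad rad_H rad_Fd rad_d by (auto intro: less_le_trans[of _ 1])
      have "eval_fps F t = expectation (\<lambda>\<omega>. cos (t * Y \<omega>))"
        using sums_unique[OF F[of t]] t by (simp add: eval_fps_def)
      then have "eval_fps H t = 0"
        unfolding H_def using lt expectation_cos_Y[of t]
        by (simp add: eval_fps_diff eval_fps_mult)
      then show "(\<lambda>n. fps_nth H n * t ^ n) sums 0"
        using sums_eval_fps[OF lt(2)] by simp
    qed simp
    then show "fps_nth H n = fps_nth 0 n" by simp
  qed
  then have "F * ?d = fps_X" by (simp add: H_def)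
  from moment_fps_eq[OF this, of n] show ?thesis by (simp add: F_def mult.assoc)
qed

end

section \<open>Transfer to the given random variable\<close>

theorem theorem2p1:
  fixes M :: "'a measure" and X :: "nat \<Rightarrow> 'a \<Rightarrow> real" and Y :: "'a \<Rightarrow> real" and n :: nat
  assumes "prob_space M"
    and "prob_space.indep_vars M (\<lambda>_. borel) X {1..}"
    and "\<And>j. j \<ge> 1 \<Longrightarrow> distributed M lborel (X j) (\<lambda>x. ennreal (1 / 2 * exp (- \<bar>x\<bar>)))"
    and "\<And>\<omega>. \<omega> \<in> space M \<Longrightarrow> Y \<omega> = (\<Sum>k. X (Suc k) \<omega> / (2 * real (Suc k) * pi))"
    and "n \<ge> 1"
  shows "(AE \<omega> in M. summable (\<lambda>k. X (Suc k) \<omega> / (2 * real (Suc k) * pi)))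
    \<and> integrable M (\<lambda>\<omega>. Y \<omega> ^ (2 * n))
    \<and> prob_space.expectation M (\<lambda>\<omega>. Y \<omega> ^ (2 * n))
        = (-1) ^ n * (real (2 * n) / 2 ^ (2 * n) * euler_num (2 * n - 1) + bernoulli_num (2 * n))
    \<and> integrable M (\<lambda>\<omega>. Y \<omega> ^ (2 * n - 1))
    \<and> prob_space.expectation M (\<lambda>\<omega>. Y \<omega> ^ (2 * n - 1)) = 0"
proof -
  interpret L: laplace_series M X
    using assms(1-3) by (intro laplace_series.intro laplace_series_axioms.intro)
  \<comment> \<open>The two functions may differ outside \<open>space M\<close>, which affects
    neither integrability nor integrals.\<close>
  have Y: "Y \<omega> = L.Y \<omega>" if "\<omega> \<in> space M" for \<omega>
    using assms(4)[OF that] unfolding L.Y_def L.\<xi>_def .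
  have int: "integrable M (\<lambda>\<omega>. Y \<omega> ^ m)" for m
    using L.integrable_Y_power[of m] Y by (simp cong: Bochner_Integration.integrable_cong)
  have expec: "L.expectation (\<lambda>\<omega>. Y \<omega> ^ m) = L.expectation (\<lambda>\<omega>. L.Y \<omega> ^ m)" for m
    using Y by (intro Bochner_Integration.integral_cong) auto
  have "(-1) ^ n * L.expectation (\<lambda>\<omega>. Y \<omega> ^ (2 * n))
      = real (2 * n) / 2 ^ (2 * n) * euler_num (2 * n - 1) + bernoulli_num (2 * n)"
    using L.moment_Y[of "2 * n"] unfolding expec by (simp add: cos_coeff_def)
  \<comment> \<open>The sign moves to the other side because \<open>(-1) ^ n\<close> is its own
    inverse.\<close>
  from this[symmetric] have even: "L.expectation (\<lambda>\<omega>. Y \<omega> ^ (2 * n))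
      = (-1) ^ n * (real (2 * n) / 2 ^ (2 * n) * euler_num (2 * n - 1) + bernoulli_num (2 * n))"
    by (simp only: mult.assoc[symmetric] power_mult_distrib[symmetric]) simp
  have "odd (2 * n - 1)" using \<open>n \<ge> 1\<close> by auto
  then have "L.expectation (\<lambda>\<omega>. Y \<omega> ^ (2 * n - 1)) = 0"
    unfolding expec by (rule L.moment_Y_odd)
  with even int L.AE_summable_\<xi> show ?thesis by (auto simp: L.\<xi>_def)
qed

end
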